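(* Let $\mathbf{V}$ be a completely distributive (non-trivial) unital quantale. Then the category $\mathbf{KlAlg}(\mathsf{D},\mathbf{V})$ of Kleisli $(\mathsf{D},\mathbf{V})$-algebras, where $\mathsf{D}=(D,e,m)$ is the up-set monad, is concretely isomorphic to the category $\mathbf{Cls}(\mathbf{V})$ of $\mathbf{V}$-closure spaces (given by $\mathbf{V}$-graded closure operators). More precisely, a $\mathbf{V}$-tower $\alpha=(\alpha^a:X\to DX)_{a\in\mathbf{V}}$ and a $\mathbf{V}$-graded closure operator $\gamma=(\gamma^a:PX\to PX)_{a\in\mathbf{V}}$ determine each other via $$x\in\gamma^a(A)\iff A^{\mathsf{c}}\notin\alpha^a(x),$$ where $A\subseteq X$, $x\in X$, $a\in\mathbf{V}$, and $A^{\mathsf{c}}$ denotes the complement of $A$ in $X$.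
   Context: **Quantales.** A unital quantale $\mathbf{V}$ is a complete lattice with an associative operation $\otimes$ preserving suprema in each variable and a two-sided unit $k$; it is non-trivial if $\bot\neq k$. Write $a\prec b$ if for every $S\subseteq\mathbf{V}$ with $b\le\bigvee S$ there is $s\in S$ with $a\le s$. $\mathbf{V}$ is completely distributive if $b=\bigvee\{a\in\mathbf{V}\mid a\prec b\}$ for all $b\in\mathbf{V}$. $PX$ denotes the powerset of $X$. **Up-set monad.** An up-set on $X$ is a set $\mathfrak{x}$ of subsets of $X$ such that $A\in\mathfrak{x}$, $A\subseteq B\subseteq X$ imply $B\in\mathfrak{x}$. $DX$ is the set of all up-sets on $X$ (including $\emptyset$ and $PX$), ordered by reverse inclusion: $\mathfrak{x}\le\mathfrak{y}\iff\mathfrak{x}\supseteq\mathfrak{y}$; it is a complete lattice with suprema given by intersections and infima by unions. For $f:X\to Y$, $Df:DX\to DY$ is defined by $B\in Df(\mathfrak{x})\iff f^{-1}(B)\in\mathfrak{x}$. The monad $\mathsf{D}=(D,e,m)$ has $A\in e_X(x)\iff x\in A$ and $A\in m_X(\mathfrak{X})\iff A^\sharp\in\mathfrak{X}$, where $A^\sharp=\{\mathfrak{x}\in DX\mid A\in\mathfrak{x}\}$, $\mathfrak{X}\in D^2X$. **Kleisli $(\mathsf{D},\mathbf{V})$-algebras.** Maps into $DX$ are ordered pointwise, and the Kleisli composite of $\alpha:X\to DY$ and $\beta:Y\to DZ$ is $\beta\circ\alpha:=m_Z\cdot D\beta\cdot\alpha$. Objects of $\mathbf{KlAlg}(\mathsf{D},\mathbf{V})$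 are pairs $(X,\alpha)$ with $\alpha=(\alpha^a:X\to DX)_{a\in\mathbf{V}}$ a $\mathbf{V}$-tower, i.e. a family of maps with: $\alpha^{\bigvee\mathcal{A}}=\bigwedge_{a\in\mathcal{A}}\alpha^a$ for all $\mathcal{A}\subseteq\mathbf{V}$; $e_X\le\alpha^k$; $\alpha^a\circ\alpha^b\le\alpha^{a\otimes b}$ for all $a,b\in\mathbf{V}$. Morphisms $f:(X,\alpha)\to(Y,\beta)$ are maps $f:X\to Y$ with $(e_Y\cdot f)\circ\alpha^a\le\beta^a\circ(e_Y\cdot f)$ (equivalently $Df\cdot\alpha^a\le\beta^a\cdot f$) for all $a\in\mathbf{V}$; composition is as in $\mathbf{Set}$. **$\mathbf{V}$-closure spaces.** A $\mathbf{V}$-graded closure operator on $X$ is a family $\gamma=(\gamma^a:PX\to PX)_{a\in\mathbf{V}}$ such that for all $A,B\subseteq X$, $a,b\in\mathbf{V}$: ($\Gamma$1) $A\subseteq\gamma^a(A)$ whenever $a\le k$; ($\Gamma$2) $A\subseteq B$ implies $\gamma^a(A)\subseteq\gamma^a(B)$; ($\Gamma$3) $\gamma^b(\gamma^a(A))\subseteq\gamma^{a\otimes b}(A)$; ($\Gamma$4) $\gamma^a(A)=\bigcap_{b\prec a}\gamma^b(A)$ (an empty intersection is $X$). Objects of $\mathbf{Cls}(\mathbf{V})$ are sets with such an operator; a morphism $f:(X,(\gamma^a)_{a\in\mathbf{V}})\to(Y,(\delta^a)_{a\in\mathbf{V}})$ is a map $f:X\to Y$ with $f(\gamma^a(A))\subseteq\delta^a(f(A))$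 for all $a\in\mathbf{V}$, $A\subseteq X$. Concretely isomorphic means isomorphic via functors commuting with the forgetful functors to $\mathbf{Set}$. *)

theory Defs
  imports "HOL-Library.FuncSet"
begin

section \<open>Categories, functors and concrete isomorphism\<close>

text \<open>
  Hom-sets, identities and composition are indexed by objects, so the same function may be a
  morphism between several pairs of objects. \<open>Cmp C A B D g f\<close> is the composite of
  \<open>f : A \<rightarrow> B\<close> and \<open>g : B \<rightarrow> D\<close>.
\<close>

record ('o, 'm) cat =
  Ob :: "'o set"
  Hom :: "'o \<Rightarrow> 'o \<Rightarrow> 'm set"
  Idt :: "'o \<Rightarrow> 'm"
  Cmp :: "'o \<Rightarrow> 'o \<Rightarrow> 'o \<Rightarrow> 'm \<Rightarrow> 'm \<Rightarrow> 'm"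

definition is_category :: "('o, 'm) cat \<Rightarrow> bool" where
  "is_category C \<longleftrightarrow>
     (\<forall>A\<in>Ob C. Idt C A \<in> Hom C A A) \<and>
     (\<forall>A\<in>Ob C. \<forall>B\<in>Ob C. \<forall>D\<in>Ob C. \<forall>f\<in>Hom C A B. \<forall>g\<in>Hom C B D.
        Cmp C A B D g f \<in> Hom C A D) \<and>
     (\<forall>A\<in>Ob C. \<forall>B\<in>Ob C. \<forall>f\<in>Hom C A B.
        Cmp C A A B f (Idt C A) = f \<and> Cmp C A B B (Idt C B) f = f) \<and>
     (\<forall>A\<in>Ob C. \<forall>B\<in>Ob C. \<forall>D\<in>Ob C. \<forall>E\<in>Ob C.
        \<forall>f\<in>Hom C A B. \<forall>g\<in>Hom C B D. \<forall>h\<in>Hom C D E.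
        Cmp C A D E h (Cmp C A B D g f) = Cmp C A B E (Cmp C B D E h g) f)"

record ('o, 'm, 'p, 'n) funct =
  obj_map :: "'o \<Rightarrow> 'p"
  mor_map :: "'o \<Rightarrow> 'o \<Rightarrow> 'm \<Rightarrow> 'n"

definition is_functor ::
  "('o, 'm) cat \<Rightarrow> ('p, 'n) cat \<Rightarrow> ('o, 'm, 'p, 'n) funct \<Rightarrow> bool" where
  "is_functor C D F \<longleftrightarrow>
     (\<forall>A\<in>Ob C. obj_map F A \<in> Ob D) \<and>
     (\<forall>A\<in>Ob C. \<forall>B\<in>Ob C. \<forall>f\<in>Hom C A B.
        mor_map F A B f \<in> Hom D (obj_map F A) (obj_map F B)) \<and>
     (\<forall>A\<in>Ob C. mor_map F A A (Idt C A) = Idt D (obj_map F A)) \<and>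
     (\<forall>A\<in>Ob C. \<forall>B\<in>Ob C. \<forall>E\<in>Ob C. \<forall>f\<in>Hom C A B. \<forall>g\<in>Hom C B E.
        mor_map F A E (Cmp C A B E g f) =
          Cmp D (obj_map F A) (obj_map F B) (obj_map F E) (mor_map F B E g) (mor_map F A B f))"

definition functor_eq ::
  "('o, 'm) cat \<Rightarrow> ('o, 'm, 'p, 'n) funct \<Rightarrow> ('o, 'm, 'p, 'n) funct \<Rightarrow> bool" where
  "functor_eq C F G \<longleftrightarrow>
     (\<forall>A\<in>Ob C. obj_map F A = obj_map G A) \<and>
     (\<forall>A\<in>Ob C. \<forall>B\<in>Ob C. \<forall>f\<in>Hom C A B. mor_map F A B f = mor_map G A B f)"

definition id_functor :: "('o, 'm, 'o, 'm) funct" where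
  "id_functor = \<lparr>obj_map = (\<lambda>A. A), mor_map = (\<lambda>A B f. f)\<rparr>"

definition comp_functor ::
  "('p, 'n, 'q, 'l) funct \<Rightarrow> ('o, 'm, 'p, 'n) funct \<Rightarrow> ('o, 'm, 'q, 'l) funct" where
  "comp_functor G F =
     \<lparr>obj_map = (\<lambda>A. obj_map G (obj_map F A)),
      mor_map = (\<lambda>A B f. mor_map G (obj_map F A) (obj_map F B) (mor_map F A B f))\<rparr>"

definition faithful_functor ::
  "('o, 'm) cat \<Rightarrow> ('o, 'm, 'p, 'n) funct \<Rightarrow> bool" where
  "faithful_functor C F \<longleftrightarrow> (\<forall>A\<in>Ob C. \<forall>B\<in>Ob C. inj_on (mor_map F A B) (Hom C A B))"

text \<open>
  The sets are the subsets of an arbitrary type \<open>'u\<close>, which plays the role of the universe.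
  Maps \<open>X \<rightarrow> Y\<close> are total HOL functions that take the value \<open>undefined\<close> outside \<open>X\<close>, so that
  equality of maps is HOL equality.
\<close>

definition set_cat :: "('u set, 'u \<Rightarrow> 'u) cat" where
  "set_cat = \<lparr>Ob = UNIV, Hom = (\<lambda>X Y. X \<rightarrow>\<^sub>E Y), Idt = (\<lambda>X. \<lambda>x\<in>X. x),
              Cmp = (\<lambda>X Y Z g f. compose X g f)\<rparr>"

definition concrete_category ::
  "('o, 'm) cat \<Rightarrow> ('o, 'm, 'u set, 'u \<Rightarrow> 'u) funct \<Rightarrow> bool" where
  "concrete_category C U \<longleftrightarrow>
     is_category C \<and> is_functor C set_cat U \<and> faithful_functor C U"

definition concrete_isomorphism ::
  "('o, 'm) cat \<Rightarrow> ('o, 'm, 'u set, 'u \<Rightarrow> 'u) funct \<Rightarrow>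
   ('p, 'n) cat \<Rightarrow> ('p, 'n, 'u set, 'u \<Rightarrow> 'u) funct \<Rightarrow>
   ('o, 'm, 'p, 'n) funct \<Rightarrow> ('p, 'n, 'o, 'm) funct \<Rightarrow> bool" where
  "concrete_isomorphism C U D W F G \<longleftrightarrow>
     is_functor C D F \<and> is_functor D C G \<and>
     functor_eq C (comp_functor G F) id_functor \<and>
     functor_eq D (comp_functor F G) id_functor \<and>
     functor_eq C (comp_functor W F) U \<and>
     functor_eq D (comp_functor U G) W"

section \<open>Quantales\<close>

locale unital_quantale = monoid tensor k
  for tensor :: "'v::complete_lattice \<Rightarrow> 'v \<Rightarrow> 'v" and k :: 'v +
  assumes tensor_Sup_left: "tensor (Sup S) b = (SUP a\<in>S. tensor a b)"
    and tensor_Sup_right: "tensor a (Sup S) = (SUP b\<in>S. tensor a b)"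

definition totally_below :: "'v::complete_lattice \<Rightarrow> 'v \<Rightarrow> bool" (infix "\<prec>" 50) where
  "a \<prec> b \<longleftrightarrow> (\<forall>S. b \<le> Sup S \<longrightarrow> (\<exists>s\<in>S. a \<le> s))"

definition completely_distributive :: "'v::complete_lattice itself \<Rightarrow> bool" where
  "completely_distributive _ \<longleftrightarrow> (\<forall>b::'v. b = Sup {a. a \<prec> b})"

section \<open>The up-set monad\<close>

definition upsets :: "'a set \<Rightarrow> 'a set set set" where
  "upsets X = {\<xx>. \<xx> \<subseteq> Pow X \<and> (\<forall>A\<in>\<xx>. \<forall>B. A \<subseteq> B \<and> B \<subseteq> X \<longrightarrow> B \<in> \<xx>)}"

text \<open>The order is reverse inclusion, hence infima are unions (and the empty infimum is \<open>{}\<close>).\<close>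

definition upset_le :: "'a set set \<Rightarrow> 'a set set \<Rightarrow> bool" (infix "\<sqsubseteq>\<^sub>D" 50) where
  "\<xx> \<sqsubseteq>\<^sub>D \<yy> \<longleftrightarrow> \<yy> \<subseteq> \<xx>"

definition upset_Inf :: "'a set set set \<Rightarrow> 'a set set" where
  "upset_Inf S = \<Union>S"

lemma upset_Inf_greatest_lower_bound:
  assumes "S \<subseteq> upsets X"
  shows "upset_Inf S \<in> upsets X"
    and "\<xx> \<in> S \<Longrightarrow> upset_Inf S \<sqsubseteq>\<^sub>D \<xx>"
    and "(\<And>\<xx>. \<xx> \<in> S \<Longrightarrow> \<zz> \<sqsubseteq>\<^sub>D \<xx>) \<Longrightarrow> \<zz> \<sqsubseteq>\<^sub>D upset_Inf S"
  using assms unfolding upset_Inf_def upset_le_def upsets_def by blast+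

definition upset_map :: "'a set \<Rightarrow> 'b set \<Rightarrow> ('a \<Rightarrow> 'b) \<Rightarrow> 'a set set \<Rightarrow> 'b set set" where
  "upset_map X Y f \<xx> = {B. B \<subseteq> Y \<and> f -` B \<inter> X \<in> \<xx>}"

definition upset_unit :: "'a set \<Rightarrow> 'a \<Rightarrow> 'a set set" where
  "upset_unit X x = {A. A \<subseteq> X \<and> x \<in> A}"

definition sharp :: "'a set \<Rightarrow> 'a set \<Rightarrow> 'a set set set" where
  "sharp X A = {\<xx> \<in> upsets X. A \<in> \<xx>}"

definition upset_mult :: "'a set \<Rightarrow> 'a set set set set \<Rightarrow> 'a set set" where
  "upset_mult X \<XX> = {A. A \<subseteq> X \<and> sharp X A \<in> \<XX>}"

text \<open>The Kleisli composite of \<open>\<alpha> : X \<rightarrow> upsets Y\<close> and \<open>\<beta> : Y \<rightarrow> upsets Z\<close>.\<close>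

definition kleisli_comp ::
  "'b set \<Rightarrow> 'c set \<Rightarrow> ('b \<Rightarrow> 'c set set) \<Rightarrow> ('a \<Rightarrow> 'b set set) \<Rightarrow> 'a \<Rightarrow> 'c set set" where
  "kleisli_comp Y Z \<beta> \<alpha> = (\<lambda>x. upset_mult Z (upset_map Y (upsets Z) \<beta> (\<alpha> x)))"

section \<open>Kleisli algebras\<close>

definition V_tower ::
  "('v::complete_lattice \<Rightarrow> 'v \<Rightarrow> 'v) \<Rightarrow> 'v \<Rightarrow> 'a set \<Rightarrow> ('v \<Rightarrow> 'a \<Rightarrow> 'a set set) \<Rightarrow> bool" where
  "V_tower tensor k X \<alpha> \<longleftrightarrow>
     (\<forall>a. \<alpha> a \<in> X \<rightarrow>\<^sub>E upsets X) \<and>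
     (\<forall>S. \<forall>x\<in>X. \<alpha> (Sup S) x = upset_Inf ((\<lambda>a. \<alpha> a x) ` S)) \<and>
     (\<forall>x\<in>X. upset_unit X x \<sqsubseteq>\<^sub>D \<alpha> k x) \<and>
     (\<forall>a b. \<forall>x\<in>X. kleisli_comp X X (\<alpha> a) (\<alpha> b) x \<sqsubseteq>\<^sub>D \<alpha> (tensor a b) x)"

definition KlAlg_morphism ::
  "'a set \<times> ('v \<Rightarrow> 'a \<Rightarrow> 'a set set) \<Rightarrow> 'b set \<times> ('v \<Rightarrow> 'b \<Rightarrow> 'b set set) \<Rightarrow>
   ('a \<Rightarrow> 'b) \<Rightarrow> bool" where
  "KlAlg_morphism = (\<lambda>(X, \<alpha>) (Y, \<beta>) f. f \<in> X \<rightarrow>\<^sub>E Y \<and>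
     (\<forall>a. \<forall>x\<in>X. kleisli_comp X Y (upset_unit Y \<circ> f) (\<alpha> a) x
                 \<sqsubseteq>\<^sub>D kleisli_comp Y Y (\<beta> a) (upset_unit Y \<circ> f) x))"

definition KlAlg ::
  "('v::complete_lattice \<Rightarrow> 'v \<Rightarrow> 'v) \<Rightarrow> 'v \<Rightarrow>
   ('u set \<times> ('v \<Rightarrow> 'u \<Rightarrow> 'u set set), 'u \<Rightarrow> 'u) cat" where
  "KlAlg tensor k =
     \<lparr>Ob = {(X, \<alpha>). V_tower tensor k X \<alpha>},
      Hom = (\<lambda>A B. {f. KlAlg_morphism A B f}),
      Idt = (\<lambda>A. \<lambda>x\<in>fst A. x),
      Cmp = (\<lambda>A B C g f. compose (fst A) g f)\<rparr>"

section \<open>Graded closure spaces\<close>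

text \<open>In the last clause, \<open>X \<inter> \<dots>\<close> makes the empty intersection equal to \<open>X\<close>.\<close>

definition graded_closure ::
  "('v::complete_lattice \<Rightarrow> 'v \<Rightarrow> 'v) \<Rightarrow> 'v \<Rightarrow> 'a set \<Rightarrow> ('v \<Rightarrow> 'a set \<Rightarrow> 'a set) \<Rightarrow> bool" where
  "graded_closure tensor k X \<gamma> \<longleftrightarrow>
     (\<forall>a. \<gamma> a \<in> Pow X \<rightarrow>\<^sub>E Pow X) \<and>
     (\<forall>a A. a \<le> k \<and> A \<subseteq> X \<longrightarrow> A \<subseteq> \<gamma> a A) \<and>
     (\<forall>a A B. A \<subseteq> B \<and> B \<subseteq> X \<longrightarrow> \<gamma> a A \<subseteq> \<gamma> a B) \<and>
     (\<forall>a b A. A \<subseteq> X \<longrightarrow> \<gamma> b (\<gamma> a A) \<subseteq> \<gamma> (tensor a b) A) \<and>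
     (\<forall>a A. A \<subseteq> X \<longrightarrow> \<gamma> a A = X \<inter> (\<Inter>b\<in>{b. b \<prec> a}. \<gamma> b A))"

definition Cls_morphism ::
  "'a set \<times> ('v \<Rightarrow> 'a set \<Rightarrow> 'a set) \<Rightarrow> 'b set \<times> ('v \<Rightarrow> 'b set \<Rightarrow> 'b set) \<Rightarrow>
   ('a \<Rightarrow> 'b) \<Rightarrow> bool" where
  "Cls_morphism = (\<lambda>(X, \<gamma>) (Y, \<delta>) f. f \<in> X \<rightarrow>\<^sub>E Y \<and>
     (\<forall>a A. A \<subseteq> X \<longrightarrow> f ` \<gamma> a A \<subseteq> \<delta> a (f ` A)))"

definition Cls ::
  "('v::complete_lattice \<Rightarrow> 'v \<Rightarrow> 'v) \<Rightarrow> 'v \<Rightarrow>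
   ('u set \<times> ('v \<Rightarrow> 'u set \<Rightarrow> 'u set), 'u \<Rightarrow> 'u) cat" where
  "Cls tensor k =
     \<lparr>Ob = {(X, \<gamma>). graded_closure tensor k X \<gamma>},
      Hom = (\<lambda>A B. {f. Cls_morphism A B f}),
      Idt = (\<lambda>A. \<lambda>x\<in>fst A. x),
      Cmp = (\<lambda>A B C g f. compose (fst A) g f)\<rparr>"

definition forgetful :: "('u set \<times> 's, 'u \<Rightarrow> 'u, 'u set, 'u \<Rightarrow> 'u) funct" where
  "forgetful = \<lparr>obj_map = fst, mor_map = (\<lambda>A B f. f)\<rparr>"

definition tower_closure_corr ::
  "'a set \<Rightarrow> ('v \<Rightarrow> 'a \<Rightarrow> 'a set set) \<Rightarrow> ('v \<Rightarrow> 'a set \<Rightarrow> 'a set) \<Rightarrow> bool" where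
  "tower_closure_corr X \<alpha> \<gamma> \<longleftrightarrow>
     (\<forall>a. \<forall>A\<subseteq>X. \<forall>x\<in>X. x \<in> \<gamma> a A \<longleftrightarrow> X - A \<notin> \<alpha> a x)"

end

theory Submission
  imports Defs
begin

text \<open>
  Unfolding the Kleisli composition, \<open>A\<close> belongs to \<open>(\<alpha>\<^sup>a \<circ> \<alpha>\<^sup>b)(x)\<close> iff
  \<open>{y. A \<in> \<alpha>\<^sup>a(y)}\<close> belongs to \<open>\<alpha>\<^sup>b(x)\<close>. Under complementation this set becomes \<open>\<gamma>\<^sup>a\<close> of the
  complement of \<open>A\<close>, so the tower axioms translate one by one into the closure axioms. For
  the axiom on suprema, the condition on the elements totally below \<open>a\<close> makes \<open>\<gamma>\<close> antitone in the
  grade and, since every \<open>b \<prec> Sup S\<close> lies below an element of \<open>S\<close>, turns suprema into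
  intersections; conversely, complete distributivity gives \<open>a = Sup {b. b \<prec> a}\<close>.
\<close>

section \<open>Translation formulas between towers and closure operators\<close>

definition closure_of_tower ::
  "'a set \<Rightarrow> ('v \<Rightarrow> 'a \<Rightarrow> 'a set set) \<Rightarrow> 'v \<Rightarrow> 'a set \<Rightarrow> 'a set" where
  "closure_of_tower X \<alpha> = (\<lambda>a. \<lambda>A\<in>Pow X. {x\<in>X. X - A \<notin> \<alpha> a x})"

text \<open>This solves the correspondence for the tower by taking \<open>A = X - B\<close>. Here,
  as in \<open>closure_of_tower\<close>, values outside the intended domain are
  \<open>undefined\<close>, so that the two translations can be inverse to each other as equalities
  of functions.\<close>

definition tower_of_closure ::
  "'a set \<Rightarrow> ('v \<Rightarrow> 'a set \<Rightarrow> 'a set) \<Rightarrow> 'v \<Rightarrow> 'a \<Rightarrow> 'a set set" where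
  "tower_of_closure X \<gamma> = (\<lambda>a. \<lambda>x\<in>X. {B\<in>Pow X. x \<notin> \<gamma> a (X - B)})"

section \<open>Kleisli composition and Kleisli morphisms, elementwise\<close>

text \<open>The composite asks that the preimage of \<open>sharp Z A\<close> under
  \<open>\<beta>\<close> lie in \<open>\<alpha> x\<close>; since the values of
  \<open>\<beta>\<close> are up-sets, only the condition \<open>A \<in> \<beta> y\<close> remains of
  membership in \<open>sharp Z A\<close>.\<close>

lemma mem_kleisli_comp_iff:
  assumes "\<beta> \<in> Y \<rightarrow> upsets Z"
  shows "A \<in> kleisli_comp Y Z \<beta> \<alpha> x \<longleftrightarrow> A \<subseteq> Z \<and> {y\<in>Y. A \<in> \<beta> y} \<in> \<alpha> x"
proof -
  have "\<beta> -` sharp Z A \<inter> Y = {y\<in>Y. A \<in> \<beta> y}"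
    using assms by (auto simp: sharp_def)
  moreover have "sharp Z A \<subseteq> upsets Z"
    by (auto simp: sharp_def)
  ultimately show ?thesis
    by (simp add: kleisli_comp_def upset_mult_def upset_map_def)
qed

lemma upset_unit_in_upsets: "x \<in> X \<Longrightarrow> upset_unit X x \<in> upsets X"
  by (auto simp: upset_unit_def upsets_def)

text \<open>Composition with the unit collapses: the left composite is
  \<open>upset_map X Y f (\<alpha> a x)\<close>, the right one is \<open>\<beta> a (f x)\<close>. As
  the order is reverse inclusion, the quantifier runs over the members of the right one.\<close>

lemma KlAlg_morphism_iff:
  assumes "\<And>a. \<beta> a \<in> Y \<rightarrow> upsets Y"
  shows "KlAlg_morphism (X, \<alpha>) (Y, \<beta>) f \<longleftrightarrow> f \<in> X \<rightarrow>\<^sub>E Y \<and>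
    (\<forall>a. \<forall>x\<in>X. \<forall>B\<in>\<beta> a (f x). f -` B \<inter> X \<in> \<alpha> a x)"
proof (cases "f \<in> X \<rightarrow>\<^sub>E Y")
  case True
  have "A \<in> kleisli_comp X Y (upset_unit Y \<circ> f) (\<alpha> a) x \<longleftrightarrow> A \<subseteq> Y \<and> f -` A \<inter> X \<in> \<alpha> a x"
    for A a x
  proof -
    have "upset_unit Y \<circ> f \<in> X \<rightarrow> upsets Y"
      using True by (auto intro!: upset_unit_in_upsets)
    moreover have "{y\<in>X. A \<in> (upset_unit Y \<circ> f) y} = f -` A \<inter> X" if "A \<subseteq> Y"
      using that by (auto simp: upset_unit_def)
    ultimately show ?thesis
      by (auto simp: mem_kleisli_comp_iff)
  qed
  moreover have "A \<in> kleisli_comp Y Y (\<beta> a) (upset_unit Y \<circ> f) x \<longleftrightarrow> A \<in> \<beta> a (f x)"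
    if "x \<in> X" for A a x
  proof -
    have "f x \<in> Y"
      using True that by auto
    \<comment> \<open>This absorbs the side condition \<open>A \<subseteq> Y\<close> of the Kleisli
      composite.\<close>
    then have "\<beta> a (f x) \<subseteq> Pow Y"
      using assms[of a] by (auto simp: upsets_def)
    with \<open>f x \<in> Y\<close> show ?thesis
      by (auto simp: mem_kleisli_comp_iff[OF assms] upset_unit_def)
  qed
  moreover have "\<beta> a (f x) \<subseteq> Pow Y" if "x \<in> X" for a x
    using True that assms[of a] by (fastforce simp: upsets_def)
  ultimately show ?thesis
    using True by (fastforce simp: KlAlg_morphism_def upset_le_def subset_iff)
qed (simp add: KlAlg_morphism_def)

section \<open>Concreteness of both categories\<close>

text \<open>Both categories compose morphisms as functions, so the category laws come from those of
  sets, and the forgetful functor is faithful because it fixes every morphism. Only the closure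
  properties of the morphism predicate differ.\<close>

lemma concrete_category_forgetful:
  fixes P :: "'u set \<times> 's \<Rightarrow> 'u set \<times> 's \<Rightarrow> ('u \<Rightarrow> 'u) \<Rightarrow> bool"
  assumes map: "\<And>A B f. A \<in> S \<Longrightarrow> B \<in> S \<Longrightarrow> P A B f \<Longrightarrow> f \<in> fst A \<rightarrow>\<^sub>E fst B"
    and ident: "\<And>A. A \<in> S \<Longrightarrow> P A A (\<lambda>x\<in>fst A. x)"
    and comp: "\<And>A B C f g. A \<in> S \<Longrightarrow> B \<in> S \<Longrightarrow> C \<in> S \<Longrightarrow> P A B f \<Longrightarrow> P B C g \<Longrightarrow>
      P A C (compose (fst A) g f)"
  shows "concrete_category \<lparr>Ob = S, Hom = (\<lambda>A B. {f. P A B f}), Idt = (\<lambda>A. \<lambda>x\<in>fst A. x),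
      Cmp = (\<lambda>A B C g f. compose (fst A) g f)\<rparr> forgetful"
proof -
  \<comment> \<open>Outside \<open>fst A\<close> both sides are \<open>undefined\<close> by
    extensionality of \<open>f\<close>; on \<open>fst A\<close> the second law uses that
    \<open>f\<close> lands in \<open>fst B\<close>.\<close>
  have "compose (fst A) f (\<lambda>x\<in>fst A. x) = f" "compose (fst A) (\<lambda>x\<in>fst B. x) f = f"
    if "A \<in> S" "B \<in> S" "P A B f" for A B f
    using map[OF that] by (auto simp: compose_def fun_eq_iff PiE_iff extensional_def)
  moreover have "compose (fst A) h (compose (fst A) g f) = compose (fst A) (compose (fst B) h g) f"
    if "A \<in> S" "B \<in> S" "P A B f" for A B f and g h :: "'u \<Rightarrow> 'u"
    using map[OF that] by (auto simp: compose_def fun_eq_iff PiE_iff)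
  ultimately show ?thesis
    using map ident comp
    by (simp add: concrete_category_def is_category_def is_functor_def faithful_functor_def
        set_cat_def forgetful_def inj_on_def)
qed

lemma V_tower_in_upsets: "V_tower tensor k X \<alpha> \<Longrightarrow> \<alpha> a \<in> X \<rightarrow>\<^sub>E upsets X"
  by (simp add: V_tower_def)

lemma concrete_category_KlAlg: "concrete_category (KlAlg tensor k) forgetful"
  unfolding KlAlg_def
proof (rule concrete_category_forgetful; clarsimp)
  fix X Y :: "'a set" and \<alpha> \<beta> f
  assume "KlAlg_morphism (X, \<alpha> :: 'b \<Rightarrow> 'a \<Rightarrow> 'a set set) (Y, \<beta>) f"
  then show "f \<in> X \<rightarrow>\<^sub>E Y"
    by (simp add: KlAlg_morphism_def)
next
  fix X :: "'a set" and \<alpha>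
  assume \<alpha>: "V_tower tensor k X \<alpha>"
  have "(\<lambda>x\<in>X. x) -` B \<inter> X = B" if "x \<in> X" "B \<in> \<alpha> a x" for a x B
    using V_tower_in_upsets[OF \<alpha>, of a] that by (fastforce simp: upsets_def)
  with V_tower_in_upsets[OF \<alpha>] show "KlAlg_morphism (X, \<alpha>) (X, \<alpha>) (\<lambda>x\<in>X. x)"
    by (subst KlAlg_morphism_iff) auto
next
  fix X Y Z :: "'a set" and \<alpha> \<beta> \<gamma> f g
  assume towers: "V_tower tensor k Y \<beta>" "V_tower tensor k Z \<gamma>"
    and mor: "KlAlg_morphism (X, \<alpha>) (Y, \<beta>) f" "KlAlg_morphism (Y, \<beta>) (Z, \<gamma>) g"
  have \<beta>: "\<beta> a \<in> Y \<rightarrow> upsets Y" and \<gamma>: "\<gamma> a \<in> Z \<rightarrow> upsets Z" for a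
    using towers by (auto dest: V_tower_in_upsets)
  note f = mor(1)[unfolded KlAlg_morphism_iff[OF \<beta>]]
    and g = mor(2)[unfolded KlAlg_morphism_iff[OF \<gamma>]]
  \<comment> \<open>Taking the preimage in two stages lets the morphism condition for
    \<open>g\<close> feed the one for \<open>f\<close>; the inner intersection is harmless since
    \<open>f\<close> maps \<open>X\<close> into \<open>Y\<close>.\<close>
  have "compose X g f -` B \<inter> X = f -` (g -` B \<inter> Y) \<inter> X" for B
    using f by (auto simp: compose_def)
  moreover have "compose X g f \<in> X \<rightarrow>\<^sub>E Z"
    using f g by (auto simp: compose_def)
  ultimately show "KlAlg_morphism (X, \<alpha>) (Z, \<gamma>) (compose X g f)"
    unfolding KlAlg_morphism_iff[OF \<gamma>]
    using f g by (simp add: compose_eq PiE_iff del: vimage_Int)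
qed

lemma graded_closureD:
  assumes "graded_closure tensor k X \<gamma>"
  shows graded_closure_in_Pow: "\<gamma> a \<in> Pow X \<rightarrow>\<^sub>E Pow X"
    and graded_closure_extensive: "a \<le> k \<Longrightarrow> A \<subseteq> X \<Longrightarrow> A \<subseteq> \<gamma> a A"
    and graded_closure_mono: "A \<subseteq> B \<Longrightarrow> B \<subseteq> X \<Longrightarrow> \<gamma> a A \<subseteq> \<gamma> a B"
    and graded_closure_tensor: "A \<subseteq> X \<Longrightarrow> \<gamma> b (\<gamma> a A) \<subseteq> \<gamma> (tensor a b) A"
    and graded_closure_eq_INT: "A \<subseteq> X \<Longrightarrow> \<gamma> a A = X \<inter> (\<Inter>b\<in>{b. b \<prec> a}. \<gamma> b A)"
proof -
  note axioms = assms[unfolded graded_closure_def]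
  show "\<gamma> a \<in> Pow X \<rightarrow>\<^sub>E Pow X"
    using axioms[THEN conjunct1] by (rule spec)
  note axioms = axioms[THEN conjunct2]
  show "a \<le> k \<Longrightarrow> A \<subseteq> X \<Longrightarrow> A \<subseteq> \<gamma> a A"
    using axioms[THEN conjunct1] by blast
  note axioms = axioms[THEN conjunct2]
  show "A \<subseteq> B \<Longrightarrow> B \<subseteq> X \<Longrightarrow> \<gamma> a A \<subseteq> \<gamma> a B"
    using axioms[THEN conjunct1] by blast
  note axioms = axioms[THEN conjunct2]
  show "A \<subseteq> X \<Longrightarrow> \<gamma> b (\<gamma> a A) \<subseteq> \<gamma> (tensor a b) A"
    using axioms[THEN conjunct1] by blast
  show "A \<subseteq> X \<Longrightarrow> \<gamma> a A = X \<inter> (\<Inter>b\<in>{b. b \<prec> a}. \<gamma> b A)"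
    using axioms[THEN conjunct2, THEN spec, THEN spec] by (rule mp)
qed

lemma graded_closure_subset:
  assumes "graded_closure tensor k X \<gamma>" "A \<subseteq> X"
  shows "\<gamma> a A \<subseteq> X"
  using graded_closure_in_Pow[OF assms(1), of a] assms(2) by (auto simp: PiE_iff Pi_iff)

lemma concrete_category_Cls: "concrete_category (Cls tensor k) forgetful"
  unfolding Cls_def
proof (rule concrete_category_forgetful; clarsimp)
  fix X Y :: "'a set" and \<gamma> \<delta> f
  assume "Cls_morphism (X, \<gamma> :: 'b \<Rightarrow> 'a set \<Rightarrow> 'a set) (Y, \<delta>) f"
  then show "f \<in> X \<rightarrow>\<^sub>E Y"
    by (simp add: Cls_morphism_def)
next
  fix X :: "'a set" and \<gamma>
  assume "graded_closure tensor k X \<gamma>"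
  then have "\<gamma> a A \<subseteq> X" if "A \<subseteq> X" for a A
    using that by (blast dest: graded_closure_subset)
  moreover have "(\<lambda>x\<in>X. x) ` A = A" if "A \<subseteq> X" for A
    using that by (auto simp: image_def)
  ultimately show "Cls_morphism (X, \<gamma>) (X, \<gamma>) (\<lambda>x\<in>X. x)"
    by (auto simp: Cls_morphism_def)
next
  fix X Y Z :: "'a set" and \<alpha> \<beta> \<gamma> f g
  assume "graded_closure tensor k X \<alpha>"
    and f: "Cls_morphism (X, \<alpha>) (Y, \<beta>) f" and g: "Cls_morphism (Y, \<beta>) (Z, \<gamma>) g"
  \<comment> \<open>\<open>compose X g f\<close> agrees with \<open>g\<close> after \<open>f\<close>
    only on \<open>X\<close>, so this is needed to apply \<open>img\<close> to
    \<open>\<alpha> a A\<close>.\<close>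
  then have \<alpha>: "\<alpha> a A \<subseteq> X" if "A \<subseteq> X" for a A
    using that by (blast dest: graded_closure_subset)
  have img: "compose X g f ` A = g ` f ` A" if "A \<subseteq> X" for A
    using that by (auto simp: compose_def image_def subset_iff)
  have "compose X g f ` \<alpha> a A \<subseteq> \<gamma> a (compose X g f ` A)" if A: "A \<subseteq> X" for a A
  proof -
    have fA: "f ` A \<subseteq> Y"
      using A f by (auto simp: Cls_morphism_def)
    have "g ` f ` \<alpha> a A \<subseteq> g ` \<beta> a (f ` A)"
      using f A by (intro image_mono) (simp add: Cls_morphism_def)
    also have "\<dots> \<subseteq> \<gamma> a (g ` f ` A)"
      using g fA by (simp add: Cls_morphism_def)
    finally show ?thesis
      by (simp add: img A \<alpha>)
  qed
  moreover have "compose X g f \<in> X \<rightarrow>\<^sub>E Z"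
    using f g by (auto simp: Cls_morphism_def compose_def)
  ultimately show "Cls_morphism (X, \<alpha>) (Z, \<gamma>) (compose X g f)"
    by (simp add: Cls_morphism_def)
qed

section \<open>Dependence of a closure operator on the grade\<close>

text \<open>A family whose supremum dominates \<open>b\<close> also dominates \<open>a\<close>, so
  everything totally below \<open>a\<close> is totally below \<open>b\<close>, and the intersection
  defining the closure at \<open>b\<close> has more members.\<close>

lemma graded_closure_antitone:
  assumes "graded_closure tensor k X \<gamma>" "a \<le> b" "A \<subseteq> X"
  shows "\<gamma> b A \<subseteq> \<gamma> a A"
proof -
  have "c \<prec> b" if "c \<prec> a" for c
    using that \<open>a \<le> b\<close> by (auto simp: totally_below_def intro: order_trans)
  moreover have "\<gamma> c A = X \<inter> (\<Inter>b\<in>{b. b \<prec> c}. \<gamma> b A)" for c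
    using assms(1,3) by (rule graded_closure_eq_INT)
  ultimately show ?thesis
    by blast
qed

text \<open>This is the counterpart of the tower axiom on suprema. For empty \<open>S\<close> it
  gives \<open>X\<close> at the bottom grade, matching the empty up-set on the tower side.\<close>

lemma graded_closure_Sup:
  assumes \<gamma>: "graded_closure tensor k X \<gamma>" and A: "A \<subseteq> X"
  shows "\<gamma> (Sup S) A = X \<inter> (\<Inter>a\<in>S. \<gamma> a A)"
proof
  have "\<gamma> (Sup S) A \<subseteq> X"
    using assms by (rule graded_closure_subset)
  moreover have "\<gamma> (Sup S) A \<subseteq> \<gamma> a A" if "a \<in> S" for a
    using \<gamma> Sup_upper[OF that] A by (rule graded_closure_antitone)
  ultimately show "\<gamma> (Sup S) A \<subseteq> X \<inter> (\<Inter>a\<in>S. \<gamma> a A)"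
    by blast
next
  have "X \<inter> (\<Inter>a\<in>S. \<gamma> a A) \<subseteq> \<gamma> b A" if "b \<prec> Sup S" for b
  proof -
    have "\<exists>s\<in>S. b \<le> s"
      using that by (simp add: totally_below_def)
    then obtain s where "s \<in> S" "b \<le> s"
      by blast
    then show ?thesis
      using graded_closure_antitone[OF \<gamma> _ A] by blast
  qed
  moreover have "\<gamma> (Sup S) A = X \<inter> (\<Inter>b\<in>{b. b \<prec> Sup S}. \<gamma> b A)"
    using assms by (rule graded_closure_eq_INT)
  ultimately show "X \<inter> (\<Inter>a\<in>S. \<gamma> a A) \<subseteq> \<gamma> (Sup S) A"
    by blast
qed

section \<open>Equivalence of the two axiom systems\<close>

lemma tower_closure_corr_mem:
  assumes "tower_closure_corr X \<alpha> \<gamma>" "B \<subseteq> X" "x \<in> X"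
  shows "B \<in> \<alpha> a x \<longleftrightarrow> x \<notin> \<gamma> a (X - B)"
  using assms unfolding tower_closure_corr_def
  by (metis Diff_subset double_diff subset_refl)

lemma tower_closure_corr_upset_eq:
  assumes "tower_closure_corr X \<alpha> \<gamma>" "\<alpha> a x \<in> upsets X" "x \<in> X"
  shows "\<alpha> a x = {B\<in>Pow X. x \<notin> \<gamma> a (X - B)}"
  using tower_closure_corr_mem[OF assms(1)] assms(2,3) by (auto simp: upsets_def)

text \<open>The pair is arbitrary apart from the types of its values, so that both
  \<open>closure_of_tower\<close> and \<open>tower_of_closure\<close> can be inserted later.\<close>

lemma V_tower_iff_graded_closure:
  fixes tensor :: "'v::complete_lattice \<Rightarrow> 'v \<Rightarrow> 'v"
  assumes cd: "completely_distributive TYPE('v)"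
    and corr: "tower_closure_corr X \<alpha> \<gamma>"
    and \<alpha>: "\<And>a. \<alpha> a \<in> X \<rightarrow>\<^sub>E upsets X"
    and \<gamma>: "\<And>a. \<gamma> a \<in> Pow X \<rightarrow>\<^sub>E Pow X"
  shows "V_tower tensor k X \<alpha> \<longleftrightarrow> graded_closure tensor k X \<gamma>"
proof -
  have \<gamma>_iff: "x \<in> \<gamma> a A \<longleftrightarrow> X - A \<notin> \<alpha> a x" if "A \<subseteq> X" "x \<in> X" for a A x
    using corr that by (auto simp: tower_closure_corr_def)
  note \<alpha>_iff = tower_closure_corr_mem[OF corr]
  have \<gamma>_subset: "\<gamma> a A \<subseteq> X" if "A \<subseteq> X" for a A
    using \<gamma>[of a] that by (auto simp: PiE_iff Pi_iff)
  have \<alpha>_Pow: "\<alpha> a x \<subseteq> Pow X" if "x \<in> X" for a x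
    using \<alpha>[of a] that by (auto simp: PiE_iff Pi_iff upsets_def)
  have \<alpha>_upset: "C \<in> \<alpha> a x" if "x \<in> X" "B \<in> \<alpha> a x" "B \<subseteq> C" "C \<subseteq> X" for a x B C
    using \<alpha>[of a] that by (auto simp: PiE_iff Pi_iff upsets_def)
  have kleisli: "B \<in> kleisli_comp X X (\<alpha> a) (\<alpha> b) x \<longleftrightarrow> x \<notin> \<gamma> b (\<gamma> a (X - B))"
    if "x \<in> X" "B \<subseteq> X" for a b x B
  proof -
    have "X - {y\<in>X. B \<in> \<alpha> a y} = \<gamma> a (X - B)"
      using that \<gamma>_subset[of "X - B" a] by (auto simp: \<alpha>_iff)
    moreover have "\<alpha> a \<in> X \<rightarrow> upsets X"
      using \<alpha> by auto
    moreover have "{y\<in>X. B \<in> \<alpha> a y} \<in> \<alpha> b x \<longleftrightarrow> x \<notin> \<gamma> b (X - {y\<in>X. B \<in> \<alpha> a y})"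
      using that by (intro \<alpha>_iff) auto
    ultimately show ?thesis
      using that by (simp add: mem_kleisli_comp_iff)
  qed
  \<comment> \<open>The order on up-sets is reverse inclusion, so the left side says that each
    \<open>B\<close> in \<open>\<alpha> (tensor a b) x\<close> lies in the composite; contraposition
    with \<open>A = X - B\<close> gives the right side.\<close>
  have tensor_iff: "(\<forall>x\<in>X. kleisli_comp X X (\<alpha> a) (\<alpha> b) x \<sqsubseteq>\<^sub>D \<alpha> (tensor a b) x) \<longleftrightarrow>
      (\<forall>A\<subseteq>X. \<gamma> b (\<gamma> a A) \<subseteq> \<gamma> (tensor a b) A)" (is "?L \<longleftrightarrow> ?R") for a b
  proof
    assume L: ?L
    show ?R
    proof (intro allI impI subsetI)
      fix A x
      assume A: "A \<subseteq> X" and x: "x \<in> \<gamma> b (\<gamma> a A)"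
      then have "x \<in> X" "X - (X - A) = A"
        using \<gamma>_subset by blast+
      then show "x \<in> \<gamma> (tensor a b) A"
        using L A x kleisli[of x "X - A" a b] by (auto simp: upset_le_def \<gamma>_iff)
    qed
  next
    assume R: ?R
    show ?L
      unfolding upset_le_def
    proof (intro ballI subsetI)
      fix x B
      assume x: "x \<in> X" and B: "B \<in> \<alpha> (tensor a b) x"
      then have "B \<subseteq> X"
        using \<alpha>_Pow by blast
      then show "B \<in> kleisli_comp X X (\<alpha> a) (\<alpha> b) x"
        using R x B by (auto simp: kleisli \<alpha>_iff)
    qed
  qed
  show ?thesis
  proof
    assume V: "V_tower tensor k X \<alpha>"
    have Sup: "\<alpha> (Sup S) x = (\<Union>a\<in>S. \<alpha> a x)" if "x \<in> X" for S x
      using V that by (simp add: V_tower_def upset_Inf_def)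
    have \<gamma>_Sup: "\<gamma> (Sup S) A = X \<inter> (\<Inter>a\<in>S. \<gamma> a A)" if A: "A \<subseteq> X" for S A
    proof -
      have "x \<in> \<gamma> (Sup S) A \<longleftrightarrow> x \<in> (\<Inter>a\<in>S. \<gamma> a A)" if "x \<in> X" for x
        using A that by (simp add: \<gamma>_iff Sup)
      then show ?thesis
        using \<gamma>_subset[OF A] by blast
    qed
    have eq: "\<gamma> a A = X \<inter> (\<Inter>b\<in>{b. b \<prec> a}. \<gamma> b A)" if "A \<subseteq> X" for a A
      using \<gamma>_Sup[OF that, of "{b. b \<prec> a}"] cd by (simp add: completely_distributive_def)
    have unit: "A \<subseteq> \<gamma> a A" if "a \<le> k" "A \<subseteq> X" for a A
    proof -
      have "A \<subseteq> \<gamma> k A"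
      proof
        fix x assume "x \<in> A"
        moreover from this have "\<alpha> k x \<subseteq> upset_unit X x" "x \<in> X"
          using V that by (auto simp: V_tower_def upset_le_def)
        ultimately show "x \<in> \<gamma> k A"
          using that by (auto simp: \<gamma>_iff upset_unit_def)
      qed
      \<comment> \<open>The unit axiom yields extensivity at grade \<open>k\<close> only; writing
        \<open>k\<close> as the supremum of \<open>{a, k}\<close> carries it down to
        \<open>a\<close>.\<close>
      also have "sup a k = k"
        using that by (simp add: sup_absorb2)
      then have "\<gamma> k A \<subseteq> \<gamma> a A"
        using \<gamma>_Sup[OF that(2), of "{a, k}"] by auto
      finally show ?thesis .
    qed
    \<comment> \<open>Upward closure of \<open>\<alpha> a x\<close>, read on complements.\<close>
    have mono: "\<gamma> a A \<subseteq> \<gamma> a B" if "A \<subseteq> B" "B \<subseteq> X" for a A B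
    proof
      fix x assume x: "x \<in> \<gamma> a A"
      then have "x \<in> X"
        using that \<gamma>_subset by blast
      then show "x \<in> \<gamma> a B"
        using x that \<alpha>_upset[of x "X - B" a "X - A"] by (auto simp: \<gamma>_iff)
    qed
    have tens: "\<gamma> b (\<gamma> a A) \<subseteq> \<gamma> (tensor a b) A" if "A \<subseteq> X" for a b A
      using V that tensor_iff by (simp add: V_tower_def)
    show "graded_closure tensor k X \<gamma>"
      unfolding graded_closure_def
      by (intro conjI allI impI; (elim conjE)?; rule \<gamma> eq unit mono tens; assumption)
  next
    assume G: "graded_closure tensor k X \<gamma>"
    have "\<alpha> (Sup S) x = (\<Union>a\<in>S. \<alpha> a x)" if x: "x \<in> X" for S x
    proof -
      have "B \<in> \<alpha> (Sup S) x \<longleftrightarrow> B \<in> (\<Union>a\<in>S. \<alpha> a x)" if "B \<subseteq> X" for B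
        using x that graded_closure_Sup[OF G, of "X - B" S] by (auto simp: \<alpha>_iff)
      then show ?thesis
        using \<alpha>_Pow[OF x] by blast
    qed
    moreover have "upset_unit X x \<sqsubseteq>\<^sub>D \<alpha> k x" if x: "x \<in> X" for x
      unfolding upset_le_def
    proof
      fix B assume B: "B \<in> \<alpha> k x"
      then have "B \<subseteq> X"
        using \<alpha>_Pow[OF x] by blast
      \<comment> \<open>A point \<open>x\<close> outside \<open>B\<close> would thus lie in
        \<open>\<gamma> k (X - B)\<close>, contradicting
        \<open>B \<in> \<alpha> k x\<close>.\<close>
      moreover have "X - B \<subseteq> \<gamma> k (X - B)"
        using graded_closure_extensive[OF G] by simp
      ultimately show "B \<in> upset_unit X x"
        using x B by (auto simp: \<alpha>_iff upset_unit_def)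
    qed
    moreover have "\<forall>A\<subseteq>X. \<gamma> b (\<gamma> a A) \<subseteq> \<gamma> (tensor a b) A" for a b
      using graded_closure_tensor[OF G] by blast
    ultimately show "V_tower tensor k X \<alpha>"
      using \<alpha> by (simp add: V_tower_def upset_Inf_def tensor_iff)
  qed
qed

section \<open>The translations are well defined and unique\<close>

lemma closure_of_tower_in_Pow: "closure_of_tower X \<alpha> a \<in> Pow X \<rightarrow>\<^sub>E Pow X"
  by (auto simp: closure_of_tower_def)

lemma tower_closure_corr_closure_of_tower: "tower_closure_corr X \<alpha> (closure_of_tower X \<alpha>)"
  by (auto simp: tower_closure_corr_def closure_of_tower_def)

text \<open>Enlarging \<open>B\<close> shrinks \<open>X - B\<close>, so upward closure comes from
  monotonicity of \<open>\<gamma> a\<close>.\<close>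

lemma tower_of_closure_in_upsets:
  assumes "graded_closure tensor k X \<gamma>"
  shows "tower_of_closure X \<gamma> a \<in> X \<rightarrow>\<^sub>E upsets X"
proof -
  have "\<gamma> a (X - C) \<subseteq> \<gamma> a (X - B)" if "B \<subseteq> C" for B C
    using that by (intro graded_closure_mono[OF assms]) auto
  then show ?thesis
    by (auto simp: tower_of_closure_def upsets_def)
qed

lemma tower_closure_corr_tower_of_closure: "tower_closure_corr X (tower_of_closure X \<gamma>) \<gamma>"
  by (auto simp: tower_closure_corr_def tower_of_closure_def double_diff)

text \<open>The correspondence only speaks of subsets and points of \<open>X\<close>. Points outside
  \<open>X\<close> are excluded by the codomain, and other arguments are settled by
  extensionality.\<close>

lemma closure_of_tower_unique:
  assumes "tower_closure_corr X \<alpha> \<gamma>" "\<And>a. \<gamma> a \<in> Pow X \<rightarrow>\<^sub>E Pow X"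
  shows "\<gamma> = closure_of_tower X \<alpha>"
proof (intro ext)
  fix a A
  show "\<gamma> a A = closure_of_tower X \<alpha> a A"
  proof (cases "A \<subseteq> X")
    case True
    then have "\<gamma> a A \<subseteq> X"
      using assms(2)[of a] by (auto simp: PiE_iff Pi_iff)
    with True show ?thesis
      using assms(1) by (auto simp: closure_of_tower_def tower_closure_corr_def)
  next
    case False
    then show ?thesis
      using assms(2)[of a] by (auto simp: closure_of_tower_def PiE_iff extensional_def)
  qed
qed

lemma tower_of_closure_unique:
  assumes "tower_closure_corr X \<alpha> \<gamma>" "\<And>a. \<alpha> a \<in> X \<rightarrow>\<^sub>E upsets X"
  shows "\<alpha> = tower_of_closure X \<gamma>"
proof (intro ext)
  fix a x
  show "\<alpha> a x = tower_of_closure X \<gamma> a x"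
  proof (cases "x \<in> X")
    case True
    then show ?thesis
      using tower_closure_corr_upset_eq[OF assms(1)] assms(2)[of a]
      by (auto simp: tower_of_closure_def PiE_iff Pi_iff)
  next
    case False
    then show ?thesis
      using assms(2)[of a] by (auto simp: tower_of_closure_def PiE_iff extensional_def)
  qed
qed

section \<open>Comparison of morphisms\<close>

text \<open>One condition uses preimages, the other images. Complementation together with the
  adjunction between image and preimage links them up to an inclusion, which upward closure of the
  tower values absorbs.\<close>

lemma KlAlg_morphism_iff_Cls_morphism:
  assumes \<alpha>: "\<And>a. \<alpha> a \<in> X \<rightarrow>\<^sub>E upsets X" and \<beta>: "\<And>a. \<beta> a \<in> Y \<rightarrow>\<^sub>E upsets Y"
    and \<gamma>: "\<And>a. \<gamma> a \<in> Pow X \<rightarrow>\<^sub>E Pow X"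
    and corr: "tower_closure_corr X \<alpha> \<gamma>" "tower_closure_corr Y \<beta> \<delta>"
  shows "KlAlg_morphism (X, \<alpha>) (Y, \<beta>) f \<longleftrightarrow> Cls_morphism (X, \<gamma>) (Y, \<delta>) f"
proof (cases "f \<in> X \<rightarrow>\<^sub>E Y")
  case f: True
  have \<beta>': "\<beta> a \<in> Y \<rightarrow> upsets Y" for a
    using \<beta> by auto
  have \<alpha>_upset: "C \<in> \<alpha> a x" if "x \<in> X" "B \<in> \<alpha> a x" "B \<subseteq> C" "C \<subseteq> X" for a x B C
    using \<alpha>[of a] that by (auto simp: PiE_iff Pi_iff upsets_def)
  have "(\<forall>a. \<forall>x\<in>X. \<forall>B\<in>\<beta> a (f x). f -` B \<inter> X \<in> \<alpha> a x) \<longleftrightarrow>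
    (\<forall>a A. A \<subseteq> X \<longrightarrow> f ` \<gamma> a A \<subseteq> \<delta> a (f ` A))" (is "?L \<longleftrightarrow> ?R")
  proof
    assume L: ?L
    show ?R
    proof (intro allI impI image_subsetI)
      fix a A x
      assume A: "A \<subseteq> X" and x: "x \<in> \<gamma> a A"
      then have "x \<in> X"
        using \<gamma>[of a] by (auto simp: PiE_iff Pi_iff)
      then have fx: "f x \<in> Y" and fA: "f ` A \<subseteq> Y"
        using f A by auto
      show "f x \<in> \<delta> a (f ` A)"
      proof (rule ccontr)
        assume "f x \<notin> \<delta> a (f ` A)"
        then have "Y - f ` A \<in> \<beta> a (f x)"
          using corr(2) fx fA by (auto simp: tower_closure_corr_def)
        then have "f -` (Y - f ` A) \<inter> X \<in> \<alpha> a x"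
          using L \<open>x \<in> X\<close> by blast
        then have "X - A \<in> \<alpha> a x"
          using \<open>x \<in> X\<close> by (elim \<alpha>_upset[rotated]) auto
        then show False
          using corr(1) A x \<open>x \<in> X\<close> by (auto simp: tower_closure_corr_def)
      qed
    qed
  next
    assume R: ?R
    show ?L
    proof (intro allI ballI)
      fix a x B
      assume x: "x \<in> X" and B: "B \<in> \<beta> a (f x)"
      \<comment> \<open>The complement of the preimage of \<open>B\<close> is the set whose closure
        decides the claim; its image misses \<open>B\<close>.\<close>
      let ?A = "X - f -` B \<inter> X"
      have fx: "f x \<in> Y"
        using f x by auto
      then have "B \<subseteq> Y"
        using B \<beta>'[of a] by (auto simp: upsets_def)
      have "B \<subseteq> Y - f ` ?A"
        using \<open>B \<subseteq> Y\<close> by auto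
      then have "Y - f ` ?A \<in> \<beta> a (f x)"
        using B \<beta>'[of a] fx by (auto simp: upsets_def Pi_iff)
      moreover have "f ` ?A \<subseteq> Y"
        using f by auto
      ultimately have "f x \<notin> \<delta> a (f ` ?A)"
        using corr(2) fx by (auto simp: tower_closure_corr_def)
      then have "x \<notin> \<gamma> a ?A"
        using R by blast
      then show "f -` B \<inter> X \<in> \<alpha> a x"
        using x tower_closure_corr_mem[OF corr(1), of "f -` B \<inter> X" x a] by auto
    qed
  qed
  with f show ?thesis
    by (simp add: KlAlg_morphism_iff[OF \<beta>'] Cls_morphism_def)
qed (simp_all add: KlAlg_morphism_def Cls_morphism_def)

section \<open>The functors and the concrete isomorphism\<close>

lemma graded_closure_closure_of_tower:
  fixes tensor :: "'v::complete_lattice \<Rightarrow> 'v \<Rightarrow> 'v"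
  assumes "completely_distributive TYPE('v)" "V_tower tensor k X \<alpha>"
  shows "graded_closure tensor k X (closure_of_tower X \<alpha>)"
proof -
  have "V_tower tensor k X \<alpha> \<longleftrightarrow> graded_closure tensor k X (closure_of_tower X \<alpha>)"
    using assms(1) tower_closure_corr_closure_of_tower
  proof (rule V_tower_iff_graded_closure)
    show "\<alpha> a \<in> X \<rightarrow>\<^sub>E upsets X" for a
      using assms(2) by (rule V_tower_in_upsets)
  qed (rule closure_of_tower_in_Pow)
  with assms(2) show ?thesis
    by simp
qed

lemma V_tower_tower_of_closure:
  fixes tensor :: "'v::complete_lattice \<Rightarrow> 'v \<Rightarrow> 'v"
  assumes "completely_distributive TYPE('v)" "graded_closure tensor k X \<gamma>"
  shows "V_tower tensor k X (tower_of_closure X \<gamma>)"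
proof -
  have "V_tower tensor k X (tower_of_closure X \<gamma>) \<longleftrightarrow> graded_closure tensor k X \<gamma>"
    using assms(1) tower_closure_corr_tower_of_closure
  proof (rule V_tower_iff_graded_closure)
    show "tower_of_closure X \<gamma> a \<in> X \<rightarrow>\<^sub>E upsets X" "\<gamma> a \<in> Pow X \<rightarrow>\<^sub>E Pow X" for a
      using assms(2) by (rule tower_of_closure_in_upsets graded_closure_in_Pow)+
  qed
  with assms(2) show ?thesis
    by simp
qed

definition closure_functor ::
  "('u set \<times> ('v \<Rightarrow> 'u \<Rightarrow> 'u set set), 'u \<Rightarrow> 'u,
    'u set \<times> ('v \<Rightarrow> 'u set \<Rightarrow> 'u set), 'u \<Rightarrow> 'u) funct" where
  "closure_functor = \<lparr>obj_map = (\<lambda>(X, \<alpha>). (X, closure_of_tower X \<alpha>)), mor_map = (\<lambda>A B f. f)\<rparr>"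

definition tower_functor ::
  "('u set \<times> ('v \<Rightarrow> 'u set \<Rightarrow> 'u set), 'u \<Rightarrow> 'u,
    'u set \<times> ('v \<Rightarrow> 'u \<Rightarrow> 'u set set), 'u \<Rightarrow> 'u) funct" where
  "tower_functor = \<lparr>obj_map = (\<lambda>(X, \<gamma>). (X, tower_of_closure X \<gamma>)), mor_map = (\<lambda>A B f. f)\<rparr>"

text \<open>Both functors fix underlying sets and maps, so it remains that they preserve objects and
  morphisms and that the two translations are mutually inverse.\<close>

lemma concrete_isomorphism_KlAlg_Cls:
  fixes tensor :: "'v::complete_lattice \<Rightarrow> 'v \<Rightarrow> 'v"
  assumes cd: "completely_distributive TYPE('v)"
  shows "concrete_isomorphism
    (KlAlg tensor k :: ('u set \<times> ('v \<Rightarrow> 'u \<Rightarrow> 'u set set), 'u \<Rightarrow> 'u) cat) forgetful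
    (Cls tensor k) forgetful closure_functor tower_functor"
proof -
  note cl = graded_closure_closure_of_tower[OF cd] and tw = V_tower_tower_of_closure[OF cd]
  have mor_cl: "Cls_morphism (X, closure_of_tower X \<alpha>) (Y, closure_of_tower Y \<beta>) f"
    if "V_tower tensor k X \<alpha>" "V_tower tensor k Y \<beta>" and f: "KlAlg_morphism (X, \<alpha>) (Y, \<beta>) f"
    for X Y :: "'u set" and \<alpha> \<beta> f
  proof -
    have "\<alpha> a \<in> X \<rightarrow>\<^sub>E upsets X" "\<beta> a \<in> Y \<rightarrow>\<^sub>E upsets Y" for a
      using that(1,2) by (simp_all add: V_tower_in_upsets)
    then have "KlAlg_morphism (X, \<alpha>) (Y, \<beta>) f \<longleftrightarrow>
        Cls_morphism (X, closure_of_tower X \<alpha>) (Y, closure_of_tower Y \<beta>) f"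
      by (rule KlAlg_morphism_iff_Cls_morphism)
        (rule closure_of_tower_in_Pow tower_closure_corr_closure_of_tower)+
    with f show ?thesis
      by simp
  qed
  have mor_tw: "KlAlg_morphism (X, tower_of_closure X \<gamma>) (Y, tower_of_closure Y \<delta>) f"
    if "graded_closure tensor k X \<gamma>" "graded_closure tensor k Y \<delta>"
      and f: "Cls_morphism (X, \<gamma>) (Y, \<delta>) f"
    for X Y :: "'u set" and \<gamma> \<delta> f
  proof -
    have "tower_of_closure X \<gamma> a \<in> X \<rightarrow>\<^sub>E upsets X" "tower_of_closure Y \<delta> a \<in> Y \<rightarrow>\<^sub>E upsets Y"
      "\<gamma> a \<in> Pow X \<rightarrow>\<^sub>E Pow X" for a
      by (fact tower_of_closure_in_upsets[OF that(1)] tower_of_closure_in_upsets[OF that(2)]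
          graded_closure_in_Pow[OF that(1)])+
    then have "KlAlg_morphism (X, tower_of_closure X \<gamma>) (Y, tower_of_closure Y \<delta>) f \<longleftrightarrow>
        Cls_morphism (X, \<gamma>) (Y, \<delta>) f"
      by (rule KlAlg_morphism_iff_Cls_morphism) (rule tower_closure_corr_tower_of_closure)+
    with f show ?thesis
      by simp
  qed
  \<comment> \<open>The tower \<open>\<alpha>\<close> corresponds to its own closure operator, so
    uniqueness of the corresponding tower recovers it.\<close>
  have tw_cl: "tower_of_closure X (closure_of_tower X \<alpha>) = \<alpha>" if "V_tower tensor k X \<alpha>"
    for X :: "'u set" and \<alpha>
    by (rule tower_of_closure_unique[symmetric])
      (rule tower_closure_corr_closure_of_tower V_tower_in_upsets[OF that])+
  have cl_tw: "closure_of_tower X (tower_of_closure X \<gamma>) = \<gamma>" if "graded_closure tensor k X \<gamma>"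
    for X :: "'u set" and \<gamma>
    by (rule closure_of_tower_unique[symmetric])
      (rule tower_closure_corr_tower_of_closure graded_closure_in_Pow[OF that])+
  show ?thesis
    by (auto simp: concrete_isomorphism_def is_functor_def functor_eq_def comp_functor_def
        id_functor_def forgetful_def closure_functor_def tower_functor_def KlAlg_def Cls_def
        cl tw mor_cl mor_tw tw_cl cl_tw)
qed

theorem proposition5p6:
  fixes tensor :: "'v::complete_lattice \<Rightarrow> 'v \<Rightarrow> 'v" and k :: 'v
  assumes "unital_quantale tensor k"
    and "(bot::'v) \<noteq> k"
    and "completely_distributive TYPE('v)"
  defines "K \<equiv> KlAlg tensor k :: ('u set \<times> ('v \<Rightarrow> 'u \<Rightarrow> 'u set set), 'u \<Rightarrow> 'u) cat"
    and "C \<equiv> Cls tensor k :: ('u set \<times> ('v \<Rightarrow> 'u set \<Rightarrow> 'u set), 'u \<Rightarrow> 'u) cat"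
  shows "concrete_category K forgetful \<and> concrete_category C forgetful \<and>
    (\<exists>F G. concrete_isomorphism K forgetful C forgetful F G \<and>
       (\<forall>(X, \<alpha>)\<in>Ob K. tower_closure_corr X \<alpha> (snd (obj_map F (X, \<alpha>)))) \<and>
       (\<forall>(X, \<gamma>)\<in>Ob C. tower_closure_corr X (snd (obj_map G (X, \<gamma>))) \<gamma>)) \<and>
    (\<forall>(X::'u set) \<alpha>. V_tower tensor k X \<alpha> \<longrightarrow>
       (\<exists>!\<gamma>. graded_closure tensor k X \<gamma> \<and> tower_closure_corr X \<alpha> \<gamma>)) \<and>
    (\<forall>(X::'u set) \<gamma>. graded_closure tensor k X \<gamma> \<longrightarrow>
       (\<exists>!\<alpha>. V_tower tensor k X \<alpha> \<and> tower_closure_corr X \<alpha> \<gamma>))"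
proof -
  note cd = assms(3)
  have "\<exists>!\<gamma>. graded_closure tensor k X \<gamma> \<and> tower_closure_corr X \<alpha> \<gamma>"
    if "V_tower tensor k X \<alpha>" for X :: "'u set" and \<alpha>
  proof (rule ex1I)
    show "graded_closure tensor k X (closure_of_tower X \<alpha>) \<and>
        tower_closure_corr X \<alpha> (closure_of_tower X \<alpha>)"
      using graded_closure_closure_of_tower[OF cd that] tower_closure_corr_closure_of_tower ..
    show "\<gamma> = closure_of_tower X \<alpha>"
      if "graded_closure tensor k X \<gamma> \<and> tower_closure_corr X \<alpha> \<gamma>" for \<gamma>
      using conjunct2[OF that] graded_closure_in_Pow[OF conjunct1[OF that]]
      by (rule closure_of_tower_unique)
  qed
  moreover have "\<exists>!\<alpha>. V_tower tensor k X \<alpha> \<and> tower_closure_corr X \<alpha> \<gamma>"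
    if "graded_closure tensor k X \<gamma>" for X :: "'u set" and \<gamma>
  proof (rule ex1I)
    show "V_tower tensor k X (tower_of_closure X \<gamma>) \<and>
        tower_closure_corr X (tower_of_closure X \<gamma>) \<gamma>"
      using V_tower_tower_of_closure[OF cd that] tower_closure_corr_tower_of_closure ..
    show "\<alpha> = tower_of_closure X \<gamma>"
      if "V_tower tensor k X \<alpha> \<and> tower_closure_corr X \<alpha> \<gamma>" for \<alpha>
      using conjunct2[OF that] V_tower_in_upsets[OF conjunct1[OF that]]
      by (rule tower_of_closure_unique)
  qed
  \<comment> \<open>\<open>closure_functor\<close> and \<open>tower_functor\<close> are the
    witnesses for \<open>F\<close> and \<open>G\<close>; their object maps satisfy the
    correspondence by construction.\<close>
  moreover have "\<forall>(X, \<alpha>)\<in>Ob K. tower_closure_corr X \<alpha> (snd (obj_map closure_functor (X, \<alpha>)))"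
    by (simp add: closure_functor_def tower_closure_corr_closure_of_tower)
  moreover have "\<forall>(X, \<gamma>)\<in>Ob C. tower_closure_corr X (snd (obj_map tower_functor (X, \<gamma>))) \<gamma>"
    by (simp add: tower_functor_def tower_closure_corr_tower_of_closure)
  ultimately show ?thesis
    using concrete_isomorphism_KlAlg_Cls[OF cd]
      concrete_category_KlAlg concrete_category_Cls
    unfolding K_def C_def by blast
qed

end
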